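(* Let $(x,y)$ be an optimal solution of the linear program $\max \sum_{e\in E} w_e x_e$ subject to $\sum_{e\in\partial(v)}x_e\le 1$ and $\sum_{e\in\partial(v)} y_e\le t_v$ for all $v\in V$, $x_e=p_e y_e$ and $0\le y_e\le 1$ for all $e\in E$. Consider the algorithm that picks a uniformly random permutation $\pi$ of $E$ and considers the edges in the order $\pi$; when edge $e$ is considered, if $e$ is safe, it probes $e$ with probability $y_e/\alpha$ (independently), and otherwise does not probe $e$. With $\alpha=1+\sqrt5$ this algorithm is a $5.75$-approximation for the weighted stochastic matching problem.
   Context: Weighted stochastic matching (edge-probing model): an undirected graph $G=(V,E)$ with weights $w_e\ge 0$, probabilities $p_e\in[0,1]$ and positive integer vertex patiences $t_v$; $\partial(v)$ denotes the set of edges incident to $v$. Each edge is independently present with probability $p_e$, revealed only when probed. An edge $(u,v)$ may be probed only if $u,v$ are both unmatched and each has had fewer than its patience many incident edges probed; a present probed edge is irrevocably added to the matching. A vertex $v$ has timed out if $t_v$ edges incident to $v$ have been probed; an edge $(u,v)$ is safe when considered if neither $u$ nor $v$ is matched and neither has timed out. The value is the expected total weight of matched edges; an $\alpha$-approximation achieves at least $1/\alpha$ times the maximum expected value of any adaptive strategy. *)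

theory Defs
  imports "HOL-Probability.Probability" "HOL-Combinatorics.Multiset_Permutations"
begin

text \<open>Edges of a simple graph are two-element sets of vertices.\<close>

locale stochastic_matching_instance =
  fixes V :: "'v set" and E :: "'v set set"
    and w :: "'v set \<Rightarrow> real" and p :: "'v set \<Rightarrow> real" and t :: "'v \<Rightarrow> nat"
  assumes finite_V: "finite V"
    and edges: "e \<in> E \<Longrightarrow> e \<subseteq> V \<and> card e = 2"
    and weight_nonneg: "e \<in> E \<Longrightarrow> 0 \<le> w e"
    and prob_range: "e \<in> E \<Longrightarrow> 0 \<le> p e \<and> p e \<le> 1"
    and patience_pos: "v \<in> V \<Longrightarrow> 0 < t v"

definition incident :: "'v set set \<Rightarrow> 'v \<Rightarrow> 'v set set" where
  "incident E v = {e \<in> E. v \<in> e}"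


subsection \<open>Probing histories\<close>

text \<open>
  A history lists the probed edges in chronological order, each with the observed outcome
  (\<^term>\<open>True\<close>: the edge is present).  A present probed edge is irrevocably matched, so the
  current matching consists of all edges probed with outcome \<^term>\<open>True\<close>.
\<close>

type_synonym 'v history = "('v set \<times> bool) list"

definition probed :: "'v history \<Rightarrow> 'v set set" where
  "probed h = fst ` set h"

definition matching :: "'v history \<Rightarrow> 'v set set" where
  "matching h = {e. (e, True) \<in> set h}"

definition matched :: "'v history \<Rightarrow> 'v \<Rightarrow> bool" where
  "matched h v \<longleftrightarrow> (\<exists>e \<in> matching h. v \<in> e)"

definition timed_out :: "('v \<Rightarrow> nat) \<Rightarrow> 'v history \<Rightarrow> 'v \<Rightarrow> bool" where
  "timed_out t h v \<longleftrightarrow> t v \<le> card (incident (probed h) v)"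

definition safe :: "('v \<Rightarrow> nat) \<Rightarrow> 'v history \<Rightarrow> 'v set \<Rightarrow> bool" where
  "safe t h e \<longleftrightarrow> (\<forall>v\<in>e. \<not> matched h v \<and> \<not> timed_out t h v)"

definition expected_weight :: "('v set \<Rightarrow> real) \<Rightarrow> 'v history pmf \<Rightarrow> real" where
  "expected_weight w D = measure_pmf.expectation D (\<lambda>h. \<Sum>e\<in>matching h. w e)"

text \<open>The hidden random graph: \<open>X e\<close> says whether edge \<open>e\<close> is present.\<close>

definition realization :: "'v set set \<Rightarrow> ('v set \<Rightarrow> real) \<Rightarrow> ('v set \<Rightarrow> bool) pmf" where
  "realization E p = Pi_pmf E False (\<lambda>e. bernoulli_pmf (p e))"


subsection \<open>Adaptive strategies\<close>

text \<open>
  A strategy sees only the history so far and (possibly at random) chooses the next edge to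
  probe, or \<^term>\<open>None\<close> to stop.
\<close>

type_synonym 'v strategy = "'v history \<Rightarrow> 'v set option pmf"

definition admissible :: "'v set set \<Rightarrow> ('v \<Rightarrow> nat) \<Rightarrow> 'v strategy \<Rightarrow> bool" where
  "admissible E t \<sigma> \<longleftrightarrow>
     (\<forall>h e. Some e \<in> set_pmf (\<sigma> h) \<longrightarrow> e \<in> E \<and> e \<notin> probed h \<and> safe t h e)"

primrec run_strategy ::
  "'v strategy \<Rightarrow> ('v set \<Rightarrow> bool) \<Rightarrow> nat \<Rightarrow> 'v history \<Rightarrow> 'v history pmf" where
  "run_strategy \<sigma> X 0 h = return_pmf h"
| "run_strategy \<sigma> X (Suc n) h =
     do {
       a \<leftarrow> \<sigma> h;
       case a of
         None \<Rightarrow> return_pmf h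
       | Some e \<Rightarrow> run_strategy \<sigma> X n (h @ [(e, X e)])
     }"

text \<open>
  An admissible strategy never probes an edge twice, so \<^term>\<open>card E\<close> steps run it to completion.
\<close>

definition strategy_outcome ::
  "'v set set \<Rightarrow> ('v set \<Rightarrow> real) \<Rightarrow> 'v strategy \<Rightarrow> 'v history pmf" where
  "strategy_outcome E p \<sigma> =
     do {
       X \<leftarrow> realization E p;
       run_strategy \<sigma> X (card E) []
     }"

text \<open>
  A value is within a factor \<open>r\<close> of the maximum expected value iff it is at least \<open>1/r\<close> times
  the expected value of every adaptive strategy.
\<close>

definition is_approximation ::
  "'v set set \<Rightarrow> ('v set \<Rightarrow> real) \<Rightarrow> ('v set \<Rightarrow> real) \<Rightarrow> ('v \<Rightarrow> nat) \<Rightarrow> real \<Rightarrow>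
   'v history pmf \<Rightarrow> bool" where
  "is_approximation E w p t r D \<longleftrightarrow>
     (\<forall>\<sigma>. admissible E t \<sigma> \<longrightarrow>
        expected_weight w D \<ge> 1 / r * expected_weight w (strategy_outcome E p \<sigma>))"


subsection \<open>The linear program\<close>

definition lp_feasible ::
  "'v set \<Rightarrow> 'v set set \<Rightarrow> ('v set \<Rightarrow> real) \<Rightarrow> ('v \<Rightarrow> nat) \<Rightarrow>
   ('v set \<Rightarrow> real) \<Rightarrow> ('v set \<Rightarrow> real) \<Rightarrow> bool" where
  "lp_feasible V E p t x y \<longleftrightarrow>
     (\<forall>v\<in>V. (\<Sum>e\<in>incident E v. x e) \<le> 1) \<and>
     (\<forall>v\<in>V. (\<Sum>e\<in>incident E v. y e) \<le> real (t v)) \<and>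
     (\<forall>e\<in>E. x e = p e * y e) \<and>
     (\<forall>e\<in>E. 0 \<le> y e \<and> y e \<le> 1)"

definition lp_optimal ::
  "'v set \<Rightarrow> 'v set set \<Rightarrow> ('v set \<Rightarrow> real) \<Rightarrow> ('v set \<Rightarrow> real) \<Rightarrow> ('v \<Rightarrow> nat) \<Rightarrow>
   ('v set \<Rightarrow> real) \<Rightarrow> ('v set \<Rightarrow> real) \<Rightarrow> bool" where
  "lp_optimal V E w p t x y \<longleftrightarrow>
     lp_feasible V E p t x y \<and>
     (\<forall>x' y'. lp_feasible V E p t x' y' \<longrightarrow> (\<Sum>e\<in>E. w e * x' e) \<le> (\<Sum>e\<in>E. w e * x e))"


subsection \<open>The random-order algorithm\<close>

primrec probe_in_order ::
  "('v \<Rightarrow> nat) \<Rightarrow> ('v set \<Rightarrow> real) \<Rightarrow> real \<Rightarrow> ('v set \<Rightarrow> bool) \<Rightarrow>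
   'v set list \<Rightarrow> 'v history \<Rightarrow> 'v history pmf" where
  "probe_in_order t y \<alpha> X [] h = return_pmf h"
| "probe_in_order t y \<alpha> X (e # es) h =
     (if safe t h e
      then do {
        c \<leftarrow> bernoulli_pmf (y e / \<alpha>);
        probe_in_order t y \<alpha> X es (if c then h @ [(e, X e)] else h)
      }
      else probe_in_order t y \<alpha> X es h)"

definition random_order_probing ::
  "'v set set \<Rightarrow> ('v set \<Rightarrow> real) \<Rightarrow> ('v \<Rightarrow> nat) \<Rightarrow> ('v set \<Rightarrow> real) \<Rightarrow> real \<Rightarrow>
   'v history pmf" where
  "random_order_probing E p t y \<alpha> =
     do {
       X \<leftarrow> realization E p;
       es \<leftarrow> pmf_of_set (permutations_of_set E);
       probe_in_order t y \<alpha> X es []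
     }"

end

(*
  An adaptive strategy decides to probe an edge before learning whether it is present, so its probing
  and matching probabilities form a feasible point of the linear program, whose optimum therefore
  bounds every strategy.

  For the algorithm, consider an edge e and an endpoint v. An edge f is probed with probability at most
  y_f / \<alpha>, a given edge precedes e with probability 1/2, and two given edges both do with
  probability 1/3. If t_v = 1, then v has timed out as soon as it is matched, so by the patience
  constraint v is blocked before e with probability at most 1 / (2 \<alpha>). If t_v >= 2, then v is
  matched with probability at most 1 / (2 \<alpha>) by the matching constraint, and bounding the expected
  number of pairs of probed edges at v shows that it has timed out with probability at most
  t_v / (t_v - 1) / (3 \<alpha>^2) <= 2 / (3 \<alpha>^2). Hence e is safe with probability at least
  1 - 1/\<alpha> - 4 / (3 \<alpha>^2), and \<alpha> = 1 + sqrt 5 maximizes this bound divided by \<alpha>.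
*)

theory Submission imports Defs begin

section \<open>Probabilities and expectations over discrete distributions\<close>

lemma prob_bind_pmf:
  "measure_pmf.prob (bind_pmf M N) A = measure_pmf.expectation M (\<lambda>x. measure_pmf.prob (N x) A)"
proof -
  have "ennreal (measure_pmf.prob (bind_pmf M N) A) = (\<integral>\<^sup>+x. ennreal (measure_pmf.prob (N x) A) \<partial>M)"
    by (simp flip: measure_pmf.emeasure_eq_measure)
  also have "\<dots> = ennreal (measure_pmf.expectation M (\<lambda>x. measure_pmf.prob (N x) A))"
    by (intro nn_integral_eq_integral measure_pmf.integrable_const_bound[where B = 1]) auto
  finally show ?thesis
    by (simp add: integral_nonneg_AE)
qed

lemma prob_bernoulli_bind_pmf:
  assumes "0 \<le> q" "q \<le> 1"
  shows "measure_pmf.prob (bernoulli_pmf q \<bind> N) A =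
    q * measure_pmf.prob (N True) A + (1 - q) * measure_pmf.prob (N False) A"
  using assms by (simp add: prob_bind_pmf mult.commute)

lemma prob_eq_1I:
  assumes "\<And>h. h \<in> set_pmf D \<Longrightarrow> h \<in> A"
  shows "measure_pmf.prob D A = 1"
  using assms by (subst measure_pmf.prob_eq_1) (auto intro!: AE_pmfI)

lemma integrable_of_bool_pmf: "integrable (measure_pmf D) (\<lambda>h. of_bool (P h) :: real)"
  by (rule measure_pmf.integrable_const_bound[where B = 1]) auto

lemma expectation_of_bool: "measure_pmf.expectation D (\<lambda>h. of_bool (P h)) = measure_pmf.prob D {h. P h}"
proof -
  have "(\<lambda>h. of_bool (P h)) = indicat_real {h. P h}"
    by (simp add: fun_eq_iff indicator_def)
  then show ?thesis
    by simp
qed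

lemma integrable_weighted_indicators:
  fixes c :: "'a \<Rightarrow> real"
  shows "integrable (measure_pmf D) (\<lambda>h. \<Sum>a\<in>A. c a * of_bool (Q a h))"
  by (intro Bochner_Integration.integrable_sum integrable_mult_right integrable_of_bool_pmf)

lemma expectation_weighted_indicators:
  fixes c :: "'a \<Rightarrow> real"
  shows "measure_pmf.expectation D (\<lambda>h. \<Sum>a\<in>A. c a * of_bool (Q a h)) =
    (\<Sum>a\<in>A. c a * measure_pmf.prob D {h. Q a h})"
  by (subst Bochner_Integration.integral_sum)
     (simp_all add: integrable_of_bool_pmf expectation_of_bool)

text \<open>Markov's inequality for a weighted count: on the support the count dominates the
  indicator of \<open>P\<close>. Unit weights give union bounds; smaller weights allow counting
  pairs of probes.\<close>

lemma prob_le_weighted_sum: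
  fixes c :: "'a \<Rightarrow> real"
  assumes "\<And>a. a \<in> A \<Longrightarrow> 0 \<le> c a"
    and "\<And>h. h \<in> set_pmf D \<Longrightarrow> P h \<Longrightarrow> 1 \<le> (\<Sum>a\<in>A. c a * of_bool (Q a h))"
  shows "measure_pmf.prob D {h. P h} \<le> (\<Sum>a\<in>A. c a * measure_pmf.prob D {h. Q a h})"
proof -
  have "measure_pmf.prob D {h. P h} = measure_pmf.expectation D (\<lambda>h. of_bool (P h))"
    by (simp add: expectation_of_bool)
  also have "\<dots> \<le> measure_pmf.expectation D (\<lambda>h. \<Sum>a\<in>A. c a * of_bool (Q a h))"
    using assms
    by (intro integral_mono_AE AE_pmfI integrable_weighted_indicators integrable_of_bool_pmf)
       (auto intro!: sum_nonneg simp: of_bool_def)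
  finally show ?thesis
    by (simp add: expectation_weighted_indicators)
qed

text \<open>An expected cardinality is at most the worst-case one; this turns bounds on single
  histories into linear program constraints.\<close>

lemma sum_prob_le_card:
  assumes "finite A" "\<And>h. h \<in> set_pmf D \<Longrightarrow> card {a \<in> A. Q a h} \<le> c"
  shows "(\<Sum>a\<in>A. measure_pmf.prob D {h. Q a h}) \<le> real c"
proof -
  have "(\<Sum>a\<in>A. measure_pmf.prob D {h. Q a h}) =
      measure_pmf.expectation D (\<lambda>h. \<Sum>a\<in>A. 1 * of_bool (Q a h))"
    by (subst expectation_weighted_indicators) simp
  also have "\<dots> \<le> real c"
    using assms by (intro measure_pmf.integral_le_const integrable_weighted_indicators AE_pmfI)
      (simp add: sum_of_bool_eq Int_def)
  finally show ?thesis .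
qed

section \<open>Independence of the hidden edges\<close>

lemma finite_set_realization: "finite E \<Longrightarrow> finite (set_pmf (realization E p))"
  unfolding realization_def
  by (rule finite_subset[OF set_Pi_pmf_subset']) (auto intro: finite_PiE_dflt)

text \<open>Independence in resampling form. Keeping the full realization on the right lets
  functions that ignore \<open>e\<close> pass through unchanged.\<close>

lemma realization_split:
  assumes "finite E" "e \<in> E"
  shows "realization E p =
    bernoulli_pmf (p e) \<bind> (\<lambda>b. map_pmf (\<lambda>X. X(e := b)) (realization E p))"
proof -
  have E: "insert e (E - {e}) = E"
    using assms by blast
  have *: "realization E p =
      bernoulli_pmf (p e) \<bind> (\<lambda>b. map_pmf (\<lambda>X. X(e := b)) (Pi_pmf (E - {e}) False (\<lambda>e. bernoulli_pmf (p e))))"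
    using Pi_pmf_insert'[of "E - {e}" e False "\<lambda>e. bernoulli_pmf (p e)"] assms(1)
    unfolding realization_def E map_pmf_def by simp
  show ?thesis
    by (subst *) (simp add: realization_def Pi_pmf_remove assms map_pmf_comp)
qed

text \<open>Invariance under updates at \<open>e\<close> says that \<open>G\<close> ignores
  \<open>X e\<close>; the presence of \<open>e\<close> is independent of the other edges, so it
  factors out.\<close>

lemma expectation_realization_edge:
  fixes G :: "('v set \<Rightarrow> bool) \<Rightarrow> real"
  assumes E: "finite E" "e \<in> E" and p: "0 \<le> p e" "p e \<le> 1"
    and G: "\<And>X b. G (X(e := b)) = G X"
  shows "measure_pmf.expectation (realization E p) (\<lambda>X. of_bool (X e) * G X) =
    p e * measure_pmf.expectation (realization E p) G"
proof -
  have "measure_pmf.expectation (realization E p) (\<lambda>X. of_bool (X e) * G X) =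
    measure_pmf.expectation (bernoulli_pmf (p e) \<bind> (\<lambda>b. map_pmf (\<lambda>X. X(e := b)) (realization E p)))
      (\<lambda>X. of_bool (X e) * G X)"
    using realization_split[OF E] by metis
  also have "\<dots> = p e * measure_pmf.expectation (realization E p) G"
    using p finite_set_realization[OF E(1)]
    by (subst pmf_expectation_bind[where A = UNIV]) (auto simp: UNIV_bool G)
  finally show ?thesis .
qed

lemma expectation_realization:
  assumes "finite E" "e \<in> E" "0 \<le> p e" "p e \<le> 1"
  shows "measure_pmf.expectation (realization E p) (\<lambda>X. of_bool (X e)) = p e"
  using expectation_realization_edge[of E e p "\<lambda>_. 1"] assms by simp

lemma expected_weight_eq_sum:
  assumes "finite E" "\<And>h. h \<in> set_pmf D \<Longrightarrow> matching h \<subseteq> E"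
  shows "expected_weight w D = (\<Sum>e\<in>E. w e * measure_pmf.prob D {h. e \<in> matching h})"
proof -
  have "expected_weight w D = measure_pmf.expectation D (\<lambda>h. \<Sum>e\<in>E. w e * of_bool (e \<in> matching h))"
    unfolding expected_weight_def
    using assms by (intro integral_cong_AE AE_pmfI) (auto simp: sum.If_cases Int_absorb1 of_bool_def if_distrib cong: if_cong)
  then show ?thesis
    by (simp add: expectation_weighted_indicators)
qed

subsection \<open>Adaptive strategies and the linear program\<close>

lemma probed_append [simp]: "probed (h @ [(e, b)]) = insert e (probed h)"
  by (auto simp: probed_def)

lemma matching_append [simp]: "matching (h @ [(e, b)]) = (if b then insert e (matching h) else matching h)"
  by (auto simp: matching_def)

lemma probed_Nil [simp]: "probed [] = {}" and matching_Nil [simp]: "matching [] = {}"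
  by (auto simp: probed_def matching_def)

lemma finite_probed [simp]: "finite (probed h)"
  by (simp add: probed_def)

lemma matching_subset_probed: "matching h \<subseteq> probed h"
  by (force simp: matching_def probed_def)

lemma finite_incident [simp]: "finite F \<Longrightarrow> finite (incident F v)"
  by (simp add: incident_def)

lemma incident_insert:
  "incident (insert e F) v = (if v \<in> e then insert e (incident F v) else incident F v)"
  by (auto simp: incident_def)

text \<open>The invariant of every run against the realization \<open>X\<close>. Averaged over runs,
  its two cardinality bounds become the two vertex constraints of the linear program.\<close>

definition valid_history :: "'v set set \<Rightarrow> ('v \<Rightarrow> nat) \<Rightarrow> ('v set \<Rightarrow> bool) \<Rightarrow> 'v history \<Rightarrow> bool" where
  "valid_history E t X h \<longleftrightarrow>
     probed h \<subseteq> E \<and> matching h = {e \<in> probed h. X e} \<and>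
     (\<forall>v. card (incident (probed h) v) \<le> t v \<and> card (incident (matching h) v) \<le> 1)"

lemma valid_history_Nil: "valid_history E t X []"
  by (simp add: valid_history_def incident_def)

lemma valid_history_step:
  assumes "valid_history E t X h" "e \<in> E" "safe t h e"
  shows "valid_history E t X (h @ [(e, X e)])"
proof -
  have 1: "card (incident (insert e (probed h)) v) \<le> t v" for v
    using assms card_insert_le_m1[of "t v" "incident (probed h) v" e]
    by (auto simp: valid_history_def safe_def timed_out_def incident_insert card_insert_if)
  \<comment> \<open>By safety no matched edge meets \<open>e\<close> so far, hence \<open>e\<close>
    can only become the first matched edge at each endpoint.\<close>
  have "v \<in> e \<Longrightarrow> incident (matching h) v = {}" for v
    using assms by (auto simp: safe_def matched_def incident_def)
  then have 2: "card (incident (insert e (matching h)) v) \<le> 1" for v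
    using assms(1) by (auto simp: incident_insert valid_history_def)
  show ?thesis
    using assms 1 2 by (auto simp: valid_history_def)
qed

lemma valid_history_run_strategy:
  assumes "admissible E t \<sigma>" "valid_history E t X h" "h' \<in> set_pmf (run_strategy \<sigma> X n h)"
  shows "valid_history E t X h'"
  using assms(2,3)
proof (induction n arbitrary: h)
  case (Suc n)
  from Suc.prems(2) obtain a where a: "a \<in> set_pmf (\<sigma> h)"
    and h': "h' \<in> set_pmf (case a of None \<Rightarrow> return_pmf h
      | Some e \<Rightarrow> run_strategy \<sigma> X n (h @ [(e, X e)]))"
    by auto
  show ?case
  proof (cases a)
    case (Some e)
    then have "e \<in> E" "safe t h e"
      using assms(1) a by (auto simp: admissible_def)
    with Suc.IH[OF valid_history_step[OF Suc.prems(1)]] Some h' show ?thesis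
      by auto
  qed (use h' Suc.prems in auto)
qed simp

lemma probed_run_strategy_mono:
  "h' \<in> set_pmf (run_strategy \<sigma> X n h) \<Longrightarrow> probed h \<subseteq> probed h'"
proof (induction n arbitrary: h)
  case (Suc n)
  then show ?case
    using Suc.IH by (force split: option.splits)
qed simp

text \<open>Until \<open>e\<close> is probed, a strategy behaves identically on realizations that differ only at \<open>e\<close>.\<close>

lemma prob_probed_run_strategy_upd:
  "measure_pmf.prob (run_strategy \<sigma> (X(e := b)) n h) {h. e \<in> probed h} =
    measure_pmf.prob (run_strategy \<sigma> X n h) {h. e \<in> probed h}"
proof (induction n arbitrary: h)
  case (Suc n)
  have "measure_pmf.prob (case a of None \<Rightarrow> return_pmf h
        | Some f \<Rightarrow> run_strategy \<sigma> (X(e := b)) n (h @ [(f, (X(e := b)) f)])) {h. e \<in> probed h} =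
      measure_pmf.prob (case a of None \<Rightarrow> return_pmf h
        | Some f \<Rightarrow> run_strategy \<sigma> X n (h @ [(f, X f)])) {h. e \<in> probed h}" for a
  proof (cases a)
    case (Some f)
    show ?thesis
    proof (cases "f = e")
      case True
      \<comment> \<open>Probed edges stay probed, so once \<open>e\<close> is probed the event is
        certain under either outcome.\<close>
      have "measure_pmf.prob (run_strategy \<sigma> Y n (h @ [(e, c)])) {h. e \<in> probed h} = 1" for Y c
        by (rule prob_eq_1I) (use probed_run_strategy_mono in fastforce)
      with True Some show ?thesis
        by simp
    qed (use Some Suc.IH in \<open>simp add: fun_upd_other del: fun_upd_apply\<close>)
  qed simp
  then show ?case
    by (simp add: prob_bind_pmf del: fun_upd_apply)
qed simp

context stochastic_matching_instance
begin

lemma finite_E: "finite E"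
  using edges finite_V by (auto intro: finite_subset[of E "Pow V"])

lemma lp_bounds_strategy:
  assumes \<sigma>: "admissible E t \<sigma>" and opt: "lp_optimal V E w p t x y"
  shows "expected_weight w (strategy_outcome E p \<sigma>) \<le> (\<Sum>e\<in>E. w e * x e)"
proof -
  define D where "D = strategy_outcome E p \<sigma>"
  define y' where "y' e = measure_pmf.prob D {h. e \<in> probed h}" for e
  have valid: "\<exists>X. valid_history E t X h" if "h \<in> set_pmf D" for h
    using that valid_history_run_strategy[OF \<sigma> valid_history_Nil]
    by (auto simp: D_def strategy_outcome_def)
  \<comment> \<open>The decision to probe \<open>e\<close> precedes the sight of \<open>X e\<close>:
    the probing probability is invariant under updates at \<open>e\<close>, so the factor
    \<open>p e\<close> splits off.\<close>
  have x': "measure_pmf.prob D {h. e \<in> matching h} = p e * y' e" if e: "e \<in> E" for e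
  proof -
    have "measure_pmf.prob (run_strategy \<sigma> X (card E) []) {h. e \<in> matching h} =
        of_bool (X e) * measure_pmf.prob (run_strategy \<sigma> X (card E) []) {h. e \<in> probed h}" for X
    proof -
      have "matching h = {e \<in> probed h. X e}" if "h \<in> set_pmf (run_strategy \<sigma> X (card E) [])" for h
        using valid_history_run_strategy[OF \<sigma> valid_history_Nil that] by (simp add: valid_history_def)
      then have "measure_pmf.prob (run_strategy \<sigma> X (card E) []) {h. e \<in> matching h} =
          measure_pmf.prob (run_strategy \<sigma> X (card E) []) {h. e \<in> probed h \<and> X e}"
        by (intro measure_pmf.finite_measure_eq_AE AE_pmfI) auto
      then show ?thesis
        by (cases "X e") auto
    qed
    then show ?thesis
      using expectation_realization_edge[OF finite_E e] prob_range[OF e]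
      by (simp add: D_def y'_def strategy_outcome_def prob_bind_pmf prob_probed_run_strategy_upd)
  qed
  \<comment> \<open>With \<open>p e * y' e\<close> as first component the coupling constraint holds
    by definition; the vertex constraints hold in every reachable history and hence on
    average.\<close>
  have "lp_feasible V E p t (\<lambda>e. p e * y' e) y'"
    unfolding lp_feasible_def
  proof (intro conjI ballI)
    fix v
    have "(\<Sum>e\<in>incident E v. p e * y' e) = (\<Sum>e\<in>incident E v. measure_pmf.prob D {h. e \<in> matching h})"
      by (rule sum.cong) (auto simp: x' incident_def)
    also have "\<dots> \<le> real 1"
    proof (rule sum_prob_le_card)
      fix h assume "h \<in> set_pmf D"
      with valid obtain X where X: "valid_history E t X h"
        by blast
      then have "{e \<in> incident E v. e \<in> matching h} = incident (matching h) v"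
        by (auto simp: valid_history_def incident_def)
      with X show "card {e \<in> incident E v. e \<in> matching h} \<le> 1"
        unfolding valid_history_def by metis
    qed (simp add: finite_E)
    finally show "(\<Sum>e\<in>incident E v. p e * y' e) \<le> 1"
      by simp
    show "(\<Sum>e\<in>incident E v. y' e) \<le> real (t v)"
      unfolding y'_def
    proof (rule sum_prob_le_card)
      fix h assume "h \<in> set_pmf D"
      with valid obtain X where X: "valid_history E t X h"
        by blast
      then have "{e \<in> incident E v. e \<in> probed h} = incident (probed h) v"
        by (auto simp: valid_history_def incident_def)
      with X show "card {e \<in> incident E v. e \<in> probed h} \<le> t v"
        by (simp add: valid_history_def)
    qed (simp add: finite_E)
  qed (auto simp: y'_def)
  with opt have "(\<Sum>e\<in>E. w e * (p e * y' e)) \<le> (\<Sum>e\<in>E. w e * x e)"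
    unfolding lp_optimal_def by blast
  moreover have "expected_weight w D = (\<Sum>e\<in>E. w e * (p e * y' e))"
  proof (subst expected_weight_eq_sum[of E])
    show "matching h \<subseteq> E" if "h \<in> set_pmf D" for h
      using valid[OF that] matching_subset_probed by (auto simp: valid_history_def)
  qed (simp_all add: finite_E x')
  ultimately show ?thesis
    by (simp add: D_def)
qed

end

subsection \<open>Probing in random order\<close>

lemma probe_in_order_append:
  "probe_in_order t y \<alpha> X (es @ es') h =
    probe_in_order t y \<alpha> X es h \<bind> probe_in_order t y \<alpha> X es'"
  by (induction es arbitrary: h) (auto simp: bind_return_pmf bind_assoc_pmf)

lemma set_probe_in_order:
  assumes "h' \<in> set_pmf (probe_in_order t y \<alpha> X es h)"
  shows "set h \<subseteq> set h'" "set h' \<subseteq> set h \<union> (\<lambda>f. (f, X f)) ` set es"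
  using assms by (induction es arbitrary: h) (fastforce split: if_splits)+

text \<open>Every probe of an edge \<open>f\<close> requires its own coin of bias \<open>y f / \<alpha>\<close> to come up heads,
  so probing is dominated by independent coins although safety is not independent.\<close>

lemma prob_probed_le:
  assumes "distinct es" "\<And>f. f \<in> set es \<Longrightarrow> 0 \<le> y f / \<alpha> \<and> y f / \<alpha> \<le> 1" "finite F"
  shows "measure_pmf.prob (probe_in_order t y \<alpha> X es h) {h. F \<subseteq> probed h} \<le>
    (\<Prod>f\<in>F - probed h. y f / \<alpha>) * of_bool (F \<subseteq> probed h \<union> set es)"
  using assms(1,2)
proof (induction es arbitrary: h)
  case Nil
  then show ?case
    by (auto simp: indicator_def Diff_eq_empty_iff[THEN iffD2])
next
  case (Cons e es)
  let ?q = "\<lambda>f. y f / \<alpha>"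
  let ?P = "\<lambda>h. measure_pmf.prob (probe_in_order t y \<alpha> X es h) {h. F \<subseteq> probed h}"
  let ?B = "\<lambda>h es. (\<Prod>f\<in>F - probed h. ?q f) * of_bool (F \<subseteq> probed h \<union> set es)"
  let ?h' = "h @ [(e, X e)]"
  have IH: "?P h \<le> ?B h es" for h
    using Cons.prems by (intro Cons.IH) auto
  have q: "0 \<le> ?q e" "?q e \<le> 1"
    using Cons.prems by auto
  show ?case
  proof (cases "F \<subseteq> probed h \<union> set (e # es)")
    \<comment> \<open>Some edge of \<open>F\<close> is neither probed nor still to come, so both
      branches have probability zero.\<close>
    case False
    then have "\<not> F \<subseteq> probed h \<union> set es" "\<not> F \<subseteq> probed ?h' \<union> set es"
      by auto
    then have "?P h = 0" "?P ?h' = 0"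
      using IH[of h] IH[of ?h'] by (auto simp only: of_bool_eq mult_zero_right measure_le_0_iff)
    then show ?thesis
      using False q by (auto simp: prob_bernoulli_bind_pmf)
  next
    case True
    have nonneg: "0 \<le> (\<Prod>f\<in>F - probed h. ?q f)"
      using True Cons.prems(2) by (intro prod_nonneg) auto
    show ?thesis
    proof (cases "e \<in> F - probed h")
      \<comment> \<open>Each edge is considered once. Skipping a still missing \<open>e\<close> is
        therefore fatal, and only the heads branch contributes, at the cost of the factor
        \<open>?q e\<close>.\<close>
      case e: True
      have "\<not> F \<subseteq> probed h \<union> set es"
        using e Cons.prems(1) by auto
      then have "?P h \<le> 0"
        using IH[of h] by (auto simp only: of_bool_eq mult_zero_right)
      moreover have "?P ?h' \<le> (\<Prod>f\<in>F - probed h - {e}. ?q f)"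
        using IH[of ?h'] True by (simp add: Diff_insert[symmetric] split: if_splits)
      moreover have "(\<Prod>f\<in>F - probed h. ?q f) = ?q e * (\<Prod>f\<in>F - probed h - {e}. ?q f)"
        using e assms(3) by (intro prod.remove) auto
      ultimately show ?thesis
        using True q nonneg mult_left_mono[of "?P ?h'" _ "?q e"]
        by (auto simp: prob_bernoulli_bind_pmf measure_le_0_iff)
    next
      \<comment> \<open>\<open>e\<close> is not among the missing edges, so both branches obey the
        same bound, and so does their convex combination.\<close>
      case e: False
      then have "F - probed ?h' = F - probed h"
        by auto
      then have "?P h \<le> (\<Prod>f\<in>F - probed h. ?q f)" "?P ?h' \<le> (\<Prod>f\<in>F - probed h. ?q f)"
        using order_trans[OF IH[of h]] order_trans[OF IH[of ?h']] nonneg by (simp_all del: probed_append)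
      moreover from this have "?q e * ?P ?h' + (1 - ?q e) * ?P h \<le> (\<Prod>f\<in>F - probed h. ?q f)"
        using q by (intro convex_bound_le) auto
      moreover have "of_bool (F \<subseteq> probed h \<union> set (e # es)) = (1 :: real)"
        using True by (simp only: of_bool_eq)
      ultimately show ?thesis
        using q by (simp only: probe_in_order.simps if_True if_False prob_bernoulli_bind_pmf mult_1_right split: if_split) blast
    qed
  qed
qed

text \<open>It suffices that \<open>e\<close> is present, is safe on its turn and wins its coin,
  since a matched edge is never removed. For fixed \<open>X\<close> this coin is independent of the
  earlier history.\<close>

lemma prob_matched_ge:
  assumes "0 \<le> y e / \<alpha>" "y e / \<alpha> \<le> 1"
  shows "of_bool (X e) * (y e / \<alpha>) * measure_pmf.prob (probe_in_order t y \<alpha> X pre h) {h. safe t h e} \<le>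
    measure_pmf.prob (probe_in_order t y \<alpha> X (pre @ e # post) h) {h. e \<in> matching h}"
proof -
  let ?D = "probe_in_order t y \<alpha> X pre h"
  have *: "of_bool (X e) * (y e / \<alpha>) * of_bool (safe t h e) \<le>
      measure_pmf.prob (probe_in_order t y \<alpha> X (e # post) h) {h. e \<in> matching h}" for h
  proof (cases "X e \<and> safe t h e")
    case True
    have "measure_pmf.prob (probe_in_order t y \<alpha> X post (h @ [(e, True)])) {h. e \<in> matching h} = 1"
      by (rule prob_eq_1I) (use set_probe_in_order(1) in \<open>fastforce simp: matching_def\<close>)
    with True assms show ?thesis
      by (simp add: prob_bernoulli_bind_pmf)
  qed auto
  have "of_bool (X e) * (y e / \<alpha>) * measure_pmf.prob ?D {h. safe t h e} =
      measure_pmf.expectation ?D (\<lambda>h. of_bool (X e) * (y e / \<alpha>) * of_bool (safe t h e))"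
    by (simp add: expectation_of_bool)
  also have "\<dots> \<le> measure_pmf.expectation ?D
      (\<lambda>h. measure_pmf.prob (probe_in_order t y \<alpha> X (e # post) h) {h. e \<in> matching h})"
    by (intro integral_mono * integrable_mult_right integrable_of_bool_pmf
        measure_pmf.integrable_const_bound[where B = 1]) auto
  also have "\<dots> = measure_pmf.prob (probe_in_order t y \<alpha> X (pre @ e # post) h) {h. e \<in> matching h}"
    by (simp add: probe_in_order_append prob_bind_pmf del: probe_in_order.simps)
  finally show ?thesis .
qed

text \<open>Among the elements of \<open>insert e S\<close>, each is equally likely to come last.\<close>

lemma prob_before_le:
  assumes A: "finite A" "e \<in> A" "S \<subseteq> A" "e \<notin> S"
  shows "measure_pmf.prob (pmf_of_set (permutations_of_set A)) {es. S \<subseteq> set (takeWhile (\<lambda>f. f \<noteq> e) es)}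
    \<le> 1 / (real (card S) + 1)"
proof -
  let ?T = "insert e S"
  let ?Q = "permutations_of_set A"
  \<comment> \<open>\<open>?L a\<close> holds the orders in which \<open>a\<close> comes last within
    \<open>?T\<close>; \<open>?L e\<close> is the event to be bounded.\<close>
  let ?L = "\<lambda>a. {es \<in> ?Q. ?T - {a} \<subseteq> set (takeWhile (\<lambda>f. f \<noteq> a) es)}"
  have fin: "finite S"
    using A finite_subset by blast
  have card_eq: "card (?L a) = card (?L e)" if a: "a \<in> ?T" for a
  proof -
    \<comment> \<open>Relabelling by this transposition is an involution that maps \<open>?T\<close>
      to itself, so it exchanges \<open>?L a\<close> and \<open>?L e\<close>.\<close>
    let ?s = "Transposition.transpose a e"
    have aA: "a \<in> A"
      using a A by blast
    have "map ?s es \<in> ?L (?s b)" if "es \<in> ?L b" "b \<in> ?T" for es b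
    proof -
      have "map ?s es \<in> ?Q"
        using that(1) aA A(2) by (simp add: permutations_of_set_def distinct_map)
      moreover have "?T - {?s b} \<subseteq> set (takeWhile (\<lambda>f. f \<noteq> ?s b) (map ?s es))"
      proof -
        have "?s x = ?s b \<longleftrightarrow> x = b" for x
          by (metis transpose_involutory)
        then have "takeWhile (\<lambda>f. f \<noteq> ?s b) (map ?s es) = map ?s (takeWhile (\<lambda>f. f \<noteq> b) es)"
          by (simp add: takeWhile_map o_def)
        moreover have "?s ` ?T = ?T"
          by (rule transpose_image_eq) (use a in simp)
        then have "?T - {?s b} = ?s ` (?T - {b})"
          by (subst image_set_diff) auto
        ultimately show ?thesis
          using that(1) by (simp only: set_map mem_Collect_eq image_mono)
      qed
      ultimately show ?thesis
        by simp
    qed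
    from this[of _ a] this[of _ e] have "map ?s ` ?L a \<subseteq> ?L e" "map ?s ` ?L e \<subseteq> ?L a"
      using a by (simp_all add: image_subset_iff)
    moreover have "map ?s (map ?s es) = es" for es
      by (simp add: o_def)
    ultimately have "bij_betw (map ?s) (?L a) (?L e)"
      by (intro bij_betw_byWitness[where f' = "map ?s"]) simp_all
    then show ?thesis
      by (rule bij_betw_same_card)
  qed
  \<comment> \<open>Two distinct elements cannot each precede the other.\<close>
  have disj: "?L a \<inter> ?L b = {}" if ab: "a \<in> ?T" "b \<in> ?T" "a \<noteq> b" for a b
  proof (rule ccontr)
    assume "?L a \<inter> ?L b \<noteq> {}"
    then obtain es where "b \<in> set (takeWhile (\<lambda>f. f \<noteq> a) es)" "a \<in> set (takeWhile (\<lambda>f. f \<noteq> b) es)"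
      using ab by blast
    then show False
      by (induction es) (auto split: if_splits)
  qed
  \<comment> \<open>The \<open>card S + 1\<close> classes are disjoint and equally large, which
    bounds the share of each.\<close>
  have "card (\<Union>a\<in>?T. ?L a) = (\<Sum>a\<in>?T. card (?L a))"
    using fin disj by (intro card_UN_disjoint) auto
  also have "\<dots> = card ?T * card (?L e)"
    using card_eq by simp
  finally have "card ?T * card (?L e) = card (\<Union>a\<in>?T. ?L a)" ..
  also have "\<dots> \<le> card ?Q"
    by (rule card_mono) auto
  also have "card ?T = card S + 1"
    using A fin by simp
  finally have "real ((card S + 1) * card (?L e)) \<le> real (card ?Q)"
    by (simp only: of_nat_le_iff)
  then have "(real (card S) + 1) * real (card (?L e)) \<le> real (card ?Q)"
    by (simp only: of_nat_mult of_nat_add of_nat_1)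
  moreover have "?Q \<inter> {es. S \<subseteq> set (takeWhile (\<lambda>f. f \<noteq> e) es)} = ?L e"
    using A by auto
  moreover have "0 < card ?Q" "?Q \<noteq> {}"
    using A by simp_all
  ultimately show ?thesis
    by (simp add: measure_pmf_of_set field_simps del: card_permutations_of_set)
qed

section \<open>Blocking of one endpoint under a fixed order\<close>

text \<open>With patience 1 either form of blocking requires a probe at \<open>v\<close>, so one
  union bound covers both. The sum ranges over a fixed set \<open>A\<close>, and the order enters
  only through the indicators, so that it can be averaged termwise.\<close>

lemma prob_blocked_patience_1:
  fixes y :: "'v set \<Rightarrow> real"
  assumes "t v = 1" "distinct es" "\<And>f. f \<in> set es \<Longrightarrow> 0 \<le> y f / \<alpha> \<and> y f / \<alpha> \<le> 1"
    and A: "finite A" "incident (set es) v \<subseteq> A"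
  shows "measure_pmf.prob (probe_in_order t y \<alpha> X es []) {h. matched h v \<or> timed_out t h v} \<le>
    (\<Sum>f\<in>A. y f / \<alpha> * of_bool ({f} \<subseteq> set es))"
proof -
  let ?D = "probe_in_order t y \<alpha> X es []"
  have "measure_pmf.prob ?D {h. matched h v \<or> timed_out t h v} \<le>
      (\<Sum>f\<in>A. 1 * measure_pmf.prob ?D {h. {f} \<subseteq> probed h})"
  proof (rule prob_le_weighted_sum)
    fix h assume h: "h \<in> set_pmf ?D" and blocked: "matched h v \<or> timed_out t h v"
    have "incident (probed h) v \<noteq> {}"
    proof
      assume empty: "incident (probed h) v = {}"
      then have "\<not> timed_out t h v"
        using assms(1) by (simp add: timed_out_def)
      moreover have "\<not> matched h v"
        using empty matching_subset_probed by (auto simp: matched_def incident_def)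
      ultimately show False
        using blocked by blast
    qed
    then obtain f where f: "f \<in> probed h" "v \<in> f"
      by (auto simp: incident_def)
    moreover have "f \<in> A"
      using set_probe_in_order(2)[OF h] A f by (auto simp: probed_def incident_def)
    ultimately have "of_bool ({f} \<subseteq> probed h) \<le> (\<Sum>f\<in>A. of_bool ({f} \<subseteq> probed h) :: real)"
      using A by (intro member_le_sum) auto
    then show "1 \<le> (\<Sum>f\<in>A. 1 * of_bool ({f} \<subseteq> probed h) :: real)"
      using f by simp
  qed simp
  also have "\<dots> \<le> (\<Sum>f\<in>A. y f / \<alpha> * of_bool ({f} \<subseteq> set es))"
  proof (rule sum_mono)
    fix f
    show "1 * measure_pmf.prob ?D {h. {f} \<subseteq> probed h} \<le> y f / \<alpha> * of_bool ({f} \<subseteq> set es)"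
      using prob_probed_le[where F = "{f}" and h = "[]" and y = y, OF assms(2,3)] by simp
  qed
  finally show ?thesis .
qed

text \<open>Pairs are ordered so that \<open>n\<close> elements give \<open>n * (n - 1)\<close> of
  them and sums of nonnegative products over them are bounded by a full square.\<close>

definition off_diagonal :: "'a set \<Rightarrow> ('a \<times> 'a) set" where
  "off_diagonal A = {(f, g). f \<in> A \<and> g \<in> A \<and> f \<noteq> g}"

lemma off_diagonal_eq: "off_diagonal A = A \<times> A - (\<lambda>a. (a, a)) ` A"
  by (auto simp: off_diagonal_def)

lemma finite_off_diagonal: "finite A \<Longrightarrow> finite (off_diagonal A)"
  by (simp add: off_diagonal_eq)

lemma card_off_diagonal:
  assumes "finite A"
  shows "real (card (off_diagonal A)) = real (card A) * (real (card A) - 1)"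
proof -
  have "card (off_diagonal A) = card A * card A - card A"
    unfolding off_diagonal_eq using assms
    by (subst card_Diff_subset) (auto simp: card_cartesian_product card_image inj_on_def)
  then show ?thesis
    by (simp add: of_nat_diff algebra_simps)
qed

text \<open>For patience \<open>t v \<ge> 2\<close>, a timeout at \<open>v\<close> means that at least \<open>t v (t v - 1)\<close> ordered pairs of
  edges at \<open>v\<close> were probed. For \<open>t v = 1\<close> a matched vertex has timed out, so one sum suffices above.\<close>

lemma prob_blocked_patience_ge_2:
  fixes y :: "'v set \<Rightarrow> real"
  assumes t: "2 \<le> t v" and "distinct es" "\<And>f. f \<in> set es \<Longrightarrow> 0 \<le> y f / \<alpha> \<and> y f / \<alpha> \<le> 1"
    and A: "finite A" "incident (set es) v \<subseteq> A"
  shows "measure_pmf.prob (probe_in_order t y \<alpha> X es []) {h. matched h v \<or> timed_out t h v} \<le>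
    (\<Sum>f\<in>A. of_bool (X f) * (y f / \<alpha>) * of_bool ({f} \<subseteq> set es)) +
    (\<Sum>S\<in>off_diagonal A. 1 / (real (t v) * (real (t v) - 1)) * (y (fst S) / \<alpha> * (y (snd S) / \<alpha>)) *
       of_bool ({fst S, snd S} \<subseteq> set es))"
proof -
  let ?D = "probe_in_order t y \<alpha> X es []"
  \<comment> \<open>One over the number of ordered pairs among \<open>t v\<close> edges, so the
    weighted count reaches 1 at a timeout.\<close>
  let ?c = "1 / (real (t v) * (real (t v) - 1))"
  have prob_le: "measure_pmf.prob ?D {h. F \<subseteq> probed h} \<le> (\<Prod>f\<in>F. y f / \<alpha>) * of_bool (F \<subseteq> set es)"
    if "finite F" for F
    using prob_probed_le[where F = F and h = "[]" and y = y, OF assms(2,3) that] by simp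
  \<comment> \<open>A matched edge must be present in \<open>X\<close>. Keeping this factor yields
    \<open>p f * y f\<close> on average, to which the matching constraint applies.\<close>
  have "measure_pmf.prob ?D {h. matched h v} \<le>
      (\<Sum>f\<in>A. of_bool (X f) * measure_pmf.prob ?D {h. {f} \<subseteq> probed h})"
  proof (rule prob_le_weighted_sum)
    fix h assume h: "h \<in> set_pmf ?D" and "matched h v"
    then obtain f where f: "(f, True) \<in> set h" "v \<in> f"
      by (auto simp: matched_def matching_def)
    then have "f \<in> A" "X f" "f \<in> probed h"
      using set_probe_in_order(2)[OF h] A by (force simp: probed_def incident_def)+
    then have "of_bool (X f) * of_bool ({f} \<subseteq> probed h) \<le>
        (\<Sum>f\<in>A. of_bool (X f) * of_bool ({f} \<subseteq> probed h) :: real)"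
      using A by (intro member_le_sum) auto
    then show "1 \<le> (\<Sum>f\<in>A. of_bool (X f) * of_bool ({f} \<subseteq> probed h) :: real)"
      using \<open>X f\<close> \<open>f \<in> probed h\<close> by simp
  qed simp
  also have "\<dots> \<le> (\<Sum>f\<in>A. of_bool (X f) * (y f / \<alpha>) * of_bool ({f} \<subseteq> set es))"
    using prob_le[of "{f}" for f] by (intro sum_mono) simp
  finally have matched: "measure_pmf.prob ?D {h. matched h v} \<le> \<dots>" .

  have "measure_pmf.prob ?D {h. timed_out t h v} \<le>
      (\<Sum>S\<in>off_diagonal A. ?c * measure_pmf.prob ?D {h. {fst S, snd S} \<subseteq> probed h})"
  proof (rule prob_le_weighted_sum)
    fix h assume h: "h \<in> set_pmf ?D" and "timed_out t h v"
    define N where "N = incident (probed h) v"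
    have N: "t v \<le> card N" "finite N"
      using \<open>timed_out t h v\<close> by (simp_all add: timed_out_def N_def)
    have "N \<subseteq> A"
      using set_probe_in_order(2)[OF h] A by (force simp: N_def probed_def incident_def)
    have "real (t v) * (real (t v) - 1) \<le> real (card N) * (real (card N) - 1)"
      using N t by (intro mult_mono) auto
    also have "\<dots> = (\<Sum>S\<in>off_diagonal N. of_bool ({fst S, snd S} \<subseteq> probed h))"
      unfolding card_off_diagonal[OF N(2), symmetric]
      by (subst sum.cong[OF refl, where h = "\<lambda>_. 1"]) (auto simp: off_diagonal_def N_def incident_def)
    also have "\<dots> \<le> (\<Sum>S\<in>off_diagonal A. of_bool ({fst S, snd S} \<subseteq> probed h))"
      using \<open>N \<subseteq> A\<close> A by (intro sum_mono2 finite_off_diagonal) (auto simp: off_diagonal_def)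
    finally show "1 \<le> (\<Sum>S\<in>off_diagonal A. ?c * of_bool ({fst S, snd S} \<subseteq> probed h))"
      using t by (simp add: sum_distrib_left[symmetric] sum_divide_distrib[symmetric] field_simps)
  qed (use t in simp)
  also have "\<dots> \<le> (\<Sum>S\<in>off_diagonal A. ?c * (y (fst S) / \<alpha> * (y (snd S) / \<alpha>)) *
       of_bool ({fst S, snd S} \<subseteq> set es))"
  proof (rule sum_mono)
    fix S assume S: "S \<in> off_diagonal A"
    have "?c * measure_pmf.prob ?D {h. {fst S, snd S} \<subseteq> probed h} \<le>
        ?c * ((\<Prod>f\<in>{fst S, snd S}. y f / \<alpha>) * of_bool ({fst S, snd S} \<subseteq> set es))"
      using t by (intro mult_left_mono prob_le) auto
    \<comment> \<open>The two edges of a pair differ, so the product over the set really has two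
      factors.\<close>
    moreover have "(\<Prod>f\<in>{fst S, snd S}. y f / \<alpha>) = y (fst S) / \<alpha> * (y (snd S) / \<alpha>)"
      using S by (cases S) (simp add: off_diagonal_def)
    ultimately show "?c * measure_pmf.prob ?D {h. {fst S, snd S} \<subseteq> probed h} \<le>
        ?c * (y (fst S) / \<alpha> * (y (snd S) / \<alpha>)) * of_bool ({fst S, snd S} \<subseteq> set es)"
      by (simp only: mult.assoc)
  qed
  finally have "measure_pmf.prob ?D {h. timed_out t h v} \<le> \<dots>" .
  moreover have "measure_pmf.prob ?D {h. matched h v \<or> timed_out t h v} \<le>
      measure_pmf.prob ?D {h. matched h v} + measure_pmf.prob ?D {h. timed_out t h v}"
    by (subst Collect_disj_eq) (rule measure_Un_le; simp)
  ultimately show ?thesis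
    using matched by linarith
qed

text \<open>Linearity reduces this to the chance that \<open>k\<close> given edges all precede
  \<open>e\<close>: single edges give the factor 1/2 and pairs the factor 1/3.\<close>

lemma expectation_before_le:
  fixes c :: "'b \<Rightarrow> real"
  assumes "finite A" "e \<in> A"
    and "\<And>i. i \<in> I \<Longrightarrow> 0 \<le> c i" "\<And>i. i \<in> I \<Longrightarrow> F i \<subseteq> A - {e} \<and> card (F i) = k"
  shows "measure_pmf.expectation (pmf_of_set (permutations_of_set A))
      (\<lambda>es. \<Sum>i\<in>I. c i * of_bool (F i \<subseteq> set (takeWhile (\<lambda>f. f \<noteq> e) es))) \<le>
    (\<Sum>i\<in>I. c i) / (real k + 1)"
  unfolding expectation_weighted_indicators sum_divide_distrib
proof (rule sum_mono)
  fix i assume i: "i \<in> I"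
  show "c i * measure_pmf.prob (pmf_of_set (permutations_of_set A))
      {es. F i \<subseteq> set (takeWhile (\<lambda>f. f \<noteq> e) es)} \<le> c i / (real k + 1)"
    using mult_left_mono[OF prob_before_le[of A e "F i"], of "c i"] assms(1,2) assms(3,4)[OF i] by auto
qed

section \<open>Averaging over the random order and the hidden graph\<close>

context stochastic_matching_instance
begin

text \<open>The bound passes through a function \<open>G\<close> of the realization because matching
  \<open>e\<close> also requires its presence. A \<open>G\<close> that ignores \<open>X e\<close>
  can be separated from that event by independence.\<close>

lemma blocked_before_edge:
  assumes feas: "lp_feasible V E p t x y" and e: "e \<in> E" and v: "v \<in> V" and \<alpha>: "1 \<le> \<alpha>"
  shows "\<exists>G. (\<forall>X b. G (X(e := b)) = G X) \<and>
    (\<forall>X. measure_pmf.expectation (pmf_of_set (permutations_of_set E))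
        (\<lambda>es. measure_pmf.prob (probe_in_order t y \<alpha> X (takeWhile (\<lambda>f. f \<noteq> e) es) [])
          {h. matched h v \<or> timed_out t h v}) \<le> G X) \<and>
    measure_pmf.expectation (realization E p) G \<le> 1 / (2 * \<alpha>) + 2 / (3 * \<alpha>\<^sup>2)"
proof -
  \<comment> \<open>Removing \<open>e\<close> from the incident edges ensures that \<open>G\<close>
    never reads \<open>X e\<close>.\<close>
  define A where "A = incident (E - {e}) v"
  define q where "q f = y f / \<alpha>" for f
  let ?perm = "pmf_of_set (permutations_of_set E)"
  let ?pre = "\<lambda>es. takeWhile (\<lambda>f. f \<noteq> e) es"
  let ?blocked = "\<lambda>X es. measure_pmf.prob (probe_in_order t y \<alpha> X (?pre es) [])
          {h. matched h v \<or> timed_out t h v}"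
  have A: "finite A" "A \<subseteq> E - {e}" "A \<subseteq> incident E v"
    using finite_E by (auto simp: A_def incident_def)
  have q: "0 \<le> q f" "q f \<le> 1" if "f \<in> E" for f
    using feas \<alpha> that by (auto simp: q_def lp_feasible_def divide_le_eq intro: order_trans[of _ 1])
  have pre: "distinct (?pre es)" "\<And>f. f \<in> set (?pre es) \<Longrightarrow> 0 \<le> y f / \<alpha> \<and> y f / \<alpha> \<le> 1"
    "incident (set (?pre es)) v \<subseteq> A" if "es \<in> permutations_of_set E" for es
    using that q by (auto simp: permutations_of_set_def A_def incident_def q_def dest!: set_takeWhileD)
  have perm: "set_pmf ?perm = permutations_of_set E"
    using finite_E by simp
  have integrable: "integrable (measure_pmf ?perm) f" for f :: "_ \<Rightarrow> real"
    by (rule integrable_measure_pmf_finite) (simp add: perm)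
  have q_sum: "0 \<le> (\<Sum>f\<in>A. q f)" "(\<Sum>f\<in>A. q f) \<le> t v / \<alpha>"
  proof -
    show "0 \<le> (\<Sum>f\<in>A. q f)"
      using A q by (intro sum_nonneg) auto
    have "(\<Sum>f\<in>A. q f) \<le> (\<Sum>f\<in>incident E v. q f)"
      using A q finite_E by (intro sum_mono2) (auto simp: incident_def)
    also have "\<dots> \<le> t v / \<alpha>"
      using feas v \<alpha> by (auto simp: q_def lp_feasible_def sum_divide_distrib[symmetric] intro!: divide_right_mono)
    finally show "(\<Sum>f\<in>A. q f) \<le> t v / \<alpha>" .
  qed
  show ?thesis
  proof (cases "t v = 1")
    case True
    have "measure_pmf.expectation ?perm (?blocked X) \<le> (\<Sum>f\<in>A. q f) / 2" for X
    proof -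
      have "?blocked X es \<le> (\<Sum>f\<in>A. q f * of_bool ({f} \<subseteq> set (?pre es)))"
        if "es \<in> permutations_of_set E" for es
        unfolding q_def
        by (rule prob_blocked_patience_1[where t = t]) (use True pre[OF that] A(1) in blast)+
      then      have "measure_pmf.expectation ?perm (?blocked X) \<le>
          measure_pmf.expectation ?perm (\<lambda>es. \<Sum>f\<in>A. q f * of_bool ({f} \<subseteq> set (?pre es)))"
        using perm by (intro integral_mono_AE AE_pmfI integrable) simp_all
      also have "\<dots> \<le> (\<Sum>f\<in>A. q f) / (real 1 + 1)"
        using A q e by (intro expectation_before_le finite_E) auto
      finally show ?thesis
        by simp
    qed
    \<comment> \<open>The patience constraint bounds the sum by \<open>1 / \<alpha>\<close>, leaving
      the second term as slack.\<close>
    moreover have "(\<Sum>f\<in>A. q f) / 2 \<le> 1 / (2 * \<alpha>) + 2 / (3 * \<alpha>\<^sup>2)"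
      using q_sum True by (simp add: field_simps add_increasing2)
    ultimately show ?thesis
      by (intro exI[of _ "\<lambda>_. (\<Sum>f\<in>A. q f) / 2"]) simp
  next
    case False
    then have t: "2 \<le> t v"
      using patience_pos[OF v] by simp
    define T where "T = real (t v)"
    have T: "2 \<le> T"
      using t by (simp add: T_def)
    define c where "c S = 1 / (T * (T - 1)) * (q (fst S) * q (snd S))" for S
    have c: "0 \<le> c S" if "S \<in> off_diagonal A" for S
      using that A T q by (auto simp: c_def off_diagonal_def intro!: mult_nonneg_nonneg divide_nonneg_nonneg)
    have card_pair: "card {f, g} = 2" if "(f, g) \<in> off_diagonal A" for f g
      using that by (simp add: off_diagonal_def)
    \<comment> \<open>The denominators 2 and 3 come from the precedence bounds for one and two
      edges.\<close>
    define G where "G X = (\<Sum>f\<in>A. q f * of_bool (X f)) / 2 + (\<Sum>S\<in>off_diagonal A. c S) / 3" for X :: "_ \<Rightarrow> bool"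
    have "G (X(e := b)) = G X" for X b
      unfolding G_def using A by (intro arg_cong2[where f = "(+)"] arg_cong2[where f = "(/)"] sum.cong) auto
    moreover have "measure_pmf.expectation ?perm (?blocked X) \<le> G X" for X
    proof -
      have "?blocked X es \<le> (\<Sum>f\<in>A. of_bool (X f) * q f * of_bool ({f} \<subseteq> set (?pre es))) +
            (\<Sum>S\<in>off_diagonal A. c S * of_bool ({fst S, snd S} \<subseteq> set (?pre es)))"
        if "es \<in> permutations_of_set E" for es
        unfolding q_def c_def T_def
        by (rule prob_blocked_patience_ge_2[where t = t]) (use t pre[OF that] A(1) in blast)+
      then      have "measure_pmf.expectation ?perm (?blocked X) \<le>
          measure_pmf.expectation ?perm (\<lambda>es.
            (\<Sum>f\<in>A. of_bool (X f) * q f * of_bool ({f} \<subseteq> set (?pre es))) +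
            (\<Sum>S\<in>off_diagonal A. c S * of_bool ({fst S, snd S} \<subseteq> set (?pre es))))"
        using perm by (intro integral_mono_AE AE_pmfI integrable) simp_all
      also have "\<dots> =
          measure_pmf.expectation ?perm (\<lambda>es. \<Sum>f\<in>A. of_bool (X f) * q f * of_bool ({f} \<subseteq> set (?pre es))) +
          measure_pmf.expectation ?perm (\<lambda>es. \<Sum>S\<in>off_diagonal A. c S * of_bool ({fst S, snd S} \<subseteq> set (?pre es)))"
        by (intro Bochner_Integration.integral_add integrable)
      also have "\<dots> \<le> (\<Sum>f\<in>A. of_bool (X f) * q f) / (real 1 + 1) + (\<Sum>S\<in>off_diagonal A. c S) / (real 2 + 1)"
        using A q e c by (intro add_mono expectation_before_le finite_E) (auto simp: card_pair, auto simp: off_diagonal_def)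
      finally show ?thesis
        by (simp add: G_def mult.commute)
    qed
    moreover have "measure_pmf.expectation (realization E p) G \<le> 1 / (2 * \<alpha>) + 2 / (3 * \<alpha>\<^sup>2)"
    proof -
      have prob_X: "measure_pmf.prob (realization E p) {X. X f} = p f" if "f \<in> A" for f
        using expectation_realization[OF finite_E, of f p] prob_range[of f] A that
        by (auto simp: expectation_of_bool)
      have "measure_pmf.expectation (realization E p) G = (\<Sum>f\<in>A. q f * p f) / 2 + (\<Sum>S\<in>off_diagonal A. c S) / 3"
        unfolding G_def using integrable_weighted_indicators
        by (subst Bochner_Integration.integral_add)
           (auto simp: expectation_weighted_indicators prob_X intro!: integrable_divide)
      moreover have "(\<Sum>f\<in>A. q f * p f) \<le> 1 / \<alpha>"
      proof -
        have "(\<Sum>f\<in>A. q f * p f) \<le> (\<Sum>f\<in>incident E v. q f * p f)"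
          using A q finite_E prob_range by (intro sum_mono2) (auto simp: incident_def)
        also have "\<dots> = (\<Sum>f\<in>incident E v. x f) / \<alpha>"
          unfolding sum_divide_distrib using feas
          by (intro sum.cong) (auto simp: q_def lp_feasible_def incident_def)
        also have "\<dots> \<le> 1 / \<alpha>"
          using feas v \<alpha> by (auto simp: lp_feasible_def intro!: divide_right_mono)
        finally show ?thesis .
      qed
      moreover have "(\<Sum>S\<in>off_diagonal A. c S) \<le> 2 / \<alpha>\<^sup>2"
      proof -
        \<comment> \<open>Restoring the diagonal completes the square of a sum that the patience
          constraint bounds.\<close>
        have "(\<Sum>S\<in>off_diagonal A. q (fst S) * q (snd S)) \<le> (\<Sum>S\<in>A \<times> A. q (fst S) * q (snd S))"
          using A q by (intro sum_mono2) (auto simp: off_diagonal_def)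
        also have "\<dots> = (\<Sum>f\<in>A. q f)\<^sup>2"
          by (simp add: sum_product power2_eq_square sum.cartesian_product case_prod_beta)
        also have "\<dots> \<le> (T / \<alpha>)\<^sup>2"
          using q_sum by (intro power_mono) (auto simp: T_def)
        finally have "(\<Sum>S\<in>off_diagonal A. c S) \<le> 1 / (T * (T - 1)) * (T / \<alpha>)\<^sup>2"
          using T unfolding c_def sum_distrib_left[symmetric] by (intro mult_left_mono) auto
        also have "\<dots> = T / (T - 1) / \<alpha>\<^sup>2"
          using T by (simp add: power2_eq_square)
        \<comment> \<open>\<open>T / (T - 1)\<close> is largest at the smallest patience of this
          case, \<open>T = 2\<close>.\<close>
        also have "\<dots> \<le> 2 / \<alpha>\<^sup>2"
          using T by (intro divide_right_mono) (auto simp: field_simps)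
        finally show ?thesis .
      qed
      ultimately show ?thesis
        by simp
    qed
    ultimately show ?thesis
      by blast
  qed
qed

text \<open>Averaging over orders with the realization fixed makes the endpoint bounds
  \<open>G v\<close> available; averaging over realizations then separates the factor
  \<open>p e\<close>.\<close>

lemma prob_matched_random_order_ge:
  assumes feas: "lp_feasible V E p t x y" and e: "e \<in> E" and \<alpha>: "1 \<le> \<alpha>"
  shows "x e / \<alpha> * (1 - 1 / \<alpha> - 4 / (3 * \<alpha>\<^sup>2)) \<le>
    measure_pmf.prob (random_order_probing E p t y \<alpha>) {h. e \<in> matching h}"
proof -
  let ?perm = "pmf_of_set (permutations_of_set E)"
  let ?pre = "\<lambda>es. takeWhile (\<lambda>f. f \<noteq> e) es"
  let ?blocked = "\<lambda>X es v. measure_pmf.prob (probe_in_order t y \<alpha> X (?pre es) [])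
          {h. matched h v \<or> timed_out t h v}"
  define q where "q = y e / \<alpha>"
  have q: "0 \<le> q" "q \<le> 1"
    using feas \<alpha> e by (auto simp: q_def lp_feasible_def divide_le_eq intro: order_trans[of _ 1])
  have eV: "e \<subseteq> V" "card e = 2" "finite e"
    using edges[OF e] finite_subset[OF _ finite_V] by simp_all
  have perm: "set_pmf ?perm = permutations_of_set E"
    using finite_E by simp
  have integrable: "integrable (measure_pmf ?perm) f" "integrable (measure_pmf (realization E p)) g"
    for f g :: "_ \<Rightarrow> real"
    using finite_E by (auto intro!: integrable_measure_pmf_finite simp: perm finite_set_realization)
  have "\<forall>v\<in>e. \<exists>G. (\<forall>X b. G (X(e := b)) = G X) \<and>
      (\<forall>X. measure_pmf.expectation ?perm (\<lambda>es. ?blocked X es v) \<le> G X) \<and>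
      measure_pmf.expectation (realization E p) G \<le> 1 / (2 * \<alpha>) + 2 / (3 * \<alpha>\<^sup>2)"
    using eV(1) by (intro ballI blocked_before_edge[OF feas e _ \<alpha>]) auto
  then obtain G where "\<forall>v\<in>e. (\<forall>X b. G v (X(e := b)) = G v X) \<and>
      (\<forall>X. measure_pmf.expectation ?perm (\<lambda>es. ?blocked X es v) \<le> G v X) \<and>
      measure_pmf.expectation (realization E p) (G v) \<le> 1 / (2 * \<alpha>) + 2 / (3 * \<alpha>\<^sup>2)"
    by (elim bchoice[THEN exE])
  then have G: "\<And>v X b. v \<in> e \<Longrightarrow> G v (X(e := b)) = G v X"
      "\<And>v X. v \<in> e \<Longrightarrow> measure_pmf.expectation ?perm (\<lambda>es. ?blocked X es v) \<le> G v X"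
      "\<And>v. v \<in> e \<Longrightarrow> measure_pmf.expectation (realization E p) (G v) \<le> 1 / (2 * \<alpha>) + 2 / (3 * \<alpha>\<^sup>2)"
    by (simp_all del: fun_upd_apply)
  have ord: "of_bool (X e) * q * (1 - (\<Sum>v\<in>e. ?blocked X es v)) \<le>
      measure_pmf.prob (probe_in_order t y \<alpha> X es []) {h. e \<in> matching h}"
    if "es \<in> permutations_of_set E" for X es
  proof -
    let ?D = "probe_in_order t y \<alpha> X (?pre es) []"
    \<comment> \<open>\<open>e\<close> is unsafe only if one of its endpoints is blocked.\<close>
    have "measure_pmf.prob ?D {h. \<not> safe t h e} \<le> measure_pmf.prob ?D (\<Union>v\<in>e. {h. matched h v \<or> timed_out t h v})"
      by (rule measure_pmf.finite_measure_mono) (auto simp: safe_def)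
    also have "\<dots> \<le> (\<Sum>v\<in>e. ?blocked X es v)"
      using eV by (intro measure_pmf.finite_measure_subadditive_finite) auto
    finally have "1 - (\<Sum>v\<in>e. ?blocked X es v) \<le> measure_pmf.prob ?D {h. safe t h e}"
      using measure_pmf.prob_compl[of "{h. safe t h e}" ?D] by (simp add: Collect_neg_eq Compl_eq_Diff_UNIV)
    then have "of_bool (X e) * q * (1 - (\<Sum>v\<in>e. ?blocked X es v)) \<le>
        of_bool (X e) * q * measure_pmf.prob ?D {h. safe t h e}"
      using q by (intro mult_left_mono) auto
    also have "\<dots> \<le> measure_pmf.prob (probe_in_order t y \<alpha> X (?pre es @ e # tl (dropWhile (\<lambda>f. f \<noteq> e) es)) []) {h. e \<in> matching h}"
      using q unfolding q_def by (rule prob_matched_ge)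
    \<comment> \<open>The order is split at \<open>e\<close>, so that only the edges before
      \<open>e\<close> influence its safety.\<close>
    also have "?pre es @ e # tl (dropWhile (\<lambda>f. f \<noteq> e) es) = es"
    proof -
      have "dropWhile (\<lambda>f. f \<noteq> e) es \<noteq> []"
        using that e by (auto simp: permutations_of_set_def)
      then show ?thesis
        using hd_dropWhile[of "\<lambda>f. f \<noteq> e" es]
        by (metis list.collapse takeWhile_dropWhile_id)
    qed
    finally show ?thesis .
  qed
  have "of_bool (X e) * (q * (1 - (\<Sum>v\<in>e. G v X))) \<le>
      measure_pmf.expectation ?perm (\<lambda>es. measure_pmf.prob (probe_in_order t y \<alpha> X es []) {h. e \<in> matching h})" for X
  proof -
    have "(\<Sum>v\<in>e. measure_pmf.expectation ?perm (\<lambda>es. ?blocked X es v)) \<le> (\<Sum>v\<in>e. G v X)"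
      using G(2) by (rule sum_mono)
    then have "of_bool (X e) * q * (1 - (\<Sum>v\<in>e. G v X)) \<le>
        of_bool (X e) * q * (1 - (\<Sum>v\<in>e. measure_pmf.expectation ?perm (\<lambda>es. ?blocked X es v)))"
      using q by (intro mult_left_mono) auto
    also have "\<dots> = measure_pmf.expectation ?perm (\<lambda>es. of_bool (X e) * q * (1 - (\<Sum>v\<in>e. ?blocked X es v)))"
      by (simp add: integrable Bochner_Integration.integral_diff Bochner_Integration.integral_sum)
    also have "\<dots> \<le> measure_pmf.expectation ?perm
        (\<lambda>es. measure_pmf.prob (probe_in_order t y \<alpha> X es []) {h. e \<in> matching h})"
      using ord perm by (intro integral_mono_AE AE_pmfI integrable) auto
    finally show ?thesis
      by (simp add: mult.assoc)
  qed
  then have "measure_pmf.expectation (realization E p) (\<lambda>X. of_bool (X e) * (q * (1 - (\<Sum>v\<in>e. G v X)))) \<le>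
      measure_pmf.prob (random_order_probing E p t y \<alpha>) {h. e \<in> matching h}"
    unfolding random_order_probing_def prob_bind_pmf by (intro integral_mono integrable)
  moreover have "measure_pmf.expectation (realization E p) (\<lambda>X. of_bool (X e) * (q * (1 - (\<Sum>v\<in>e. G v X)))) =
      p e * measure_pmf.expectation (realization E p) (\<lambda>X. q * (1 - (\<Sum>v\<in>e. G v X)))"
    using prob_range[OF e] G(1) by (intro expectation_realization_edge finite_E e) simp_all
  moreover have "\<dots> = p e * q * (1 - (\<Sum>v\<in>e. measure_pmf.expectation (realization E p) (G v)))"
    by (simp add: integrable Bochner_Integration.integral_diff Bochner_Integration.integral_sum)
  moreover have "p e * q * (1 - (\<Sum>v\<in>e. measure_pmf.expectation (realization E p) (G v))) \<ge>
      p e * q * (1 - 1 / \<alpha> - 4 / (3 * \<alpha>\<^sup>2))"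
  proof -
    \<comment> \<open>The two endpoints of \<open>e\<close> double the bound for a single
      one.\<close>
    have "(\<Sum>v\<in>e. measure_pmf.expectation (realization E p) (G v)) \<le> 1 / \<alpha> + 4 / (3 * \<alpha>\<^sup>2)"
      using sum_bounded_above[OF G(3), of e] eV by simp
    then show ?thesis
      using prob_range[OF e] q by (intro mult_left_mono) auto
  qed
  moreover have "p e * q = x e / \<alpha>"
    using feas e by (simp add: q_def lp_feasible_def)
  ultimately show ?thesis
    by simp
qed

end

section \<open>The approximation ratio\<close>

text \<open>The derivative in \<alpha> of the right-hand side vanishes when
  \<open>\<alpha>\<^sup>2 - 2 * \<alpha> - 4 = 0\<close>. This equation also reduces higher powers
  to linear terms.\<close>

lemma ratio_bound:
  fixes \<alpha> :: real
  assumes "\<alpha> = 1 + sqrt 5"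
  shows "1 / 5.75 \<le> 1 / \<alpha> * (1 - 1 / \<alpha> - 4 / (3 * \<alpha>\<^sup>2))"
proof -
  \<comment> \<open>The final linear inequality holds up to \<alpha> of about 3.259, so 2.25 is a
    sharp enough bound on the root.\<close>
  have "sqrt 5 \<le> 2.25"
    by (rule real_le_lsqrt) (auto simp: power2_eq_square)
  then have \<alpha>: "1 \<le> \<alpha>" "\<alpha> \<le> 3.25"
    using assms by auto
  have sq: "\<alpha>\<^sup>2 = 2 * \<alpha> + 4"
    using assms by (simp add: power2_eq_square algebra_simps)
  then have cube: "\<alpha> ^ 3 = 8 * \<alpha> + 8"
    by (simp add: power3_eq_cube power2_eq_square algebra_simps)
  have "1 / \<alpha> * (1 - 1 / \<alpha> - 4 / (3 * \<alpha>\<^sup>2)) = (3 * \<alpha>\<^sup>2 - 3 * \<alpha> - 4) / (3 * \<alpha> ^ 3)"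
    using \<alpha> by (simp add: field_simps power2_eq_square power3_eq_cube)
  also have "\<dots> = (3 * \<alpha> + 8) / (24 * \<alpha> + 24)"
    by (simp add: sq cube)
  also have "\<dots> \<ge> 1 / 5.75"
    using \<alpha> by (simp add: field_simps)
  finally show ?thesis .
qed

theorem theorem8:
  fixes V :: "'v set" and E :: "'v set set"
    and w p x y :: "'v set \<Rightarrow> real" and t :: "'v \<Rightarrow> nat" and \<alpha> :: real
  assumes "stochastic_matching_instance V E w p t"
    and "lp_optimal V E w p t x y"
    and "\<alpha> = 1 + sqrt 5"
  shows "is_approximation E w p t 5.75 (random_order_probing E p t y \<alpha>)"
  unfolding is_approximation_def
proof (intro allI impI)
  fix \<sigma> :: "'v strategy"
  assume \<sigma>: "admissible E t \<sigma>"
  interpret stochastic_matching_instance V E w p t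
    by fact
  let ?D = "random_order_probing E p t y \<alpha>"
  have feas: "lp_feasible V E p t x y"
    using assms(2) by (simp add: lp_optimal_def)
  have \<alpha>: "1 \<le> \<alpha>"
    using assms(3) by simp
  have "1 / 5.75 * expected_weight w (strategy_outcome E p \<sigma>) \<le> 1 / 5.75 * (\<Sum>e\<in>E. w e * x e)"
    using lp_bounds_strategy[OF \<sigma> assms(2)] by simp
  also have "\<dots> = (\<Sum>e\<in>E. w e * (x e * (1 / 5.75)))"
    by (simp add: sum_distrib_left mult_ac)
  \<comment> \<open>The sums are compared edge by edge; nonnegative \<open>w e\<close> and
    \<open>x e\<close> carry the ratio bound through.\<close>
  also have "\<dots> \<le> (\<Sum>e\<in>E. w e * measure_pmf.prob ?D {h. e \<in> matching h})"
  proof (intro sum_mono mult_left_mono weight_nonneg)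
    fix e assume e: "e \<in> E"
    have "0 \<le> x e"
      using feas e prob_range by (simp add: lp_feasible_def)
    then have "x e * (1 / 5.75) \<le> x e * (1 / \<alpha> * (1 - 1 / \<alpha> - 4 / (3 * \<alpha>\<^sup>2)))"
      by (intro mult_left_mono ratio_bound assms(3))
    also have "\<dots> \<le> measure_pmf.prob ?D {h. e \<in> matching h}"
      using prob_matched_random_order_ge[OF feas e \<alpha>] by simp
    finally show "x e * (1 / 5.75) \<le> measure_pmf.prob ?D {h. e \<in> matching h}" .
  qed
  also have "\<dots> = expected_weight w ?D"
  proof (rule expected_weight_eq_sum[symmetric, OF finite_E])
    fix h assume "h \<in> set_pmf ?D"
    then obtain X es where "es \<in> permutations_of_set E" "h \<in> set_pmf (probe_in_order t y \<alpha> X es [])"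
      using finite_E by (auto simp: random_order_probing_def)
    then show "matching h \<subseteq> E"
      using set_probe_in_order(2)[of h t y \<alpha> X es "[]"] by (auto simp: matching_def permutations_of_set_def)
  qed
  finally show "1 / 5.75 * expected_weight w (strategy_outcome E p \<sigma>) \<le> expected_weight w ?D" .
qed

end
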